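(* Let $\mathcal{G}$ be the ensemble of hard random geometric graphs with $n=3$ nodes, independently and uniformly distributed on the interval $[0,1]$ (with the Euclidean metric), with connection radius $r_0$. Put $$\begin{aligned}H_{[0,1]}^{<}(r_0)=&-(3r_0^2-2r_0^3)\log(3r_0^2-2r_0^3)-3\left(r_0^2-\tfrac43r_0^3\right)\log\left(r_0^2-\tfrac43r_0^3\right)\\&-3\left(\tfrac{14}{3}r_0^3-6r_0^2+2r_0\right)\log\left(\tfrac{14}{3}r_0^3-6r_0^2+2r_0\right)-(1-2r_0)^3\log\left((1-2r_0)^3\right)\end{aligned}$$ and $$\begin{aligned}H_{[0,1]}^{>}(r_0)=&-(3r_0^2-2r_0^3)\log(3r_0^2-2r_0^3)-\left(4r_0^3-(3r_0-1)^2\right)\log\left(\tfrac43r_0^3-\tfrac13(3r_0-1)^2\right)\\&-2(1-r_0)^3\log\left(\tfrac23(1-r_0)^3\right).\end{aligned}$$ Then $$H(\mathcal{G})=\begin{cases}H_{[0,1]}^{<}(r_0) & 0\le r_0<\frac12,\\ H_{[0,1]}^{>}(r_0) & \frac12\le r_0\le 1,\\ 0&\text{otherwise.}\end{cases}$$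
   Context: The hard random geometric graph with connection radius $r_0$ has vertex set $\{1,2,3\}$, positions $X_1,X_2,X_3\in[0,1]$, and an edge $(i,j)$ present if and only if $|X_i-X_j|\le r_0$. The entropy is $H(\mathcal{G})=-\sum_g\mathbb{P}(g)\log\mathbb{P}(g)$, the sum being over the labelled graphs $g$ on $\{1,2,3\}$, with logarithm to base 2 and the convention $0\log0=0$ (also used in the formulas of the claim). *)

theory Defs
  imports "HOL-Probability.Probability"
begin

(* A labelled simple graph on a fixed vertex set is represented by its set of edges,
   an edge being a two-element set of vertices. *)
definition labelled_graphs :: "'v set \<Rightarrow> 'v set set set" where
  "labelled_graphs V = Pow {e. e \<subseteq> V \<and> card e = 2}"

definition hard_rgg :: "'v set \<Rightarrow> real \<Rightarrow> ('v \<Rightarrow> real) \<Rightarrow> 'v set set" where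
  "hard_rgg V r x = {{i, j} | i j. i \<in> V \<and> j \<in> V \<and> i \<noteq> j \<and> \<bar>x i - x j\<bar> \<le> r}"

(* Here and below, 0 * log 2 0 = 0 holds in HOL. *)
definition graph_entropy :: "'a measure \<Rightarrow> 'v set \<Rightarrow> ('a \<Rightarrow> 'v set set) \<Rightarrow> real" where
  "graph_entropy M V G =
     - (\<Sum>g\<in>labelled_graphs V.
          measure M {\<omega> \<in> space M. G \<omega> = g} * log 2 (measure M {\<omega> \<in> space M. G \<omega> = g}))"

definition H_less :: "real \<Rightarrow> real" where
  "H_less r =
     - (3 * r^2 - 2 * r^3) * log 2 (3 * r^2 - 2 * r^3)
     - 3 * (r^2 - 4/3 * r^3) * log 2 (r^2 - 4/3 * r^3)
     - 3 * (14/3 * r^3 - 6 * r^2 + 2 * r) * log 2 (14/3 * r^3 - 6 * r^2 + 2 * r)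
     - (1 - 2 * r)^3 * log 2 ((1 - 2 * r)^3)"

definition H_greater :: "real \<Rightarrow> real" where
  "H_greater r =
     - (3 * r^2 - 2 * r^3) * log 2 (3 * r^2 - 2 * r^3)
     - (4 * r^3 - (3 * r - 1)^2) * log 2 (4/3 * r^3 - 1/3 * (3 * r - 1)^2)
     - 2 * (1 - r)^3 * log 2 (2/3 * (1 - r)^3)"

end

theory Submission
  imports Defs
begin

text \<open>
  A vertex is too far from a vertex at \<open>x\<close> if it lies in the left gap \<open>[0, x - r)\<close> or in the
  right gap \<open>(x + r, 1]\<close>. Conditioning on one position, the probability of any one or two
  prescribed non-edges at a vertex is an integral over \<open>x\<close> of products of gap lengths; so is that
  of three non-edges, by conditioning on the middle point in each of the six orders of the
  points. With \<open>c = (1 - r)\<^sup>+\<close> and \<open>d = (1 - 2r)\<^sup>+\<close> these probabilities are \<open>c\<^sup>2\<close>,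
  \<open>(2c\<^sup>3 + d\<^sup>3)/3\<close> and \<open>d\<^sup>3\<close> for all \<open>r \<ge> 0\<close>, and inclusion-exclusion gives the law of the graph.
\<close>

section \<open>Gap lengths under the uniform law on [0,1]\<close>

abbreviation (input) unif01 :: "real measure" where
  "unif01 \<equiv> uniform_measure lborel {0..1}"

text \<open>As simp rules these would unfold \<open>measure unif01\<close> into a quotient of
  Lebesgue measures and keep the gap lemmas from matching.\<close>

declare emeasure_uniform_measure [simp del] measure_uniform_measure [simp del]

lemma prob_space_unif01: "prob_space unif01"
  by (intro prob_space_uniform_measure) auto

text \<open>For negative \<open>t\<close> the gap is empty; truncation by \<open>max 0\<close> keeps
  one formula valid for every position and radius.\<close>

lemma measure_unif01_less:
  assumes "t \<le> 1"
  shows "measure unif01 {y. y < t} = max 0 t"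
proof -
  have "{0..1} \<inter> {y. y < t} = {0..<t}"
    using assms by auto
  then show ?thesis
    by (subst measure_uniform_measure) (auto simp: max_def)
qed

lemma measure_unif01_greater:
  assumes "0 \<le> t"
  shows "measure unif01 {y. t < y} = max 0 (1 - t)"
proof -
  have "{0..1} \<inter> {y. t < y} = {t<..1}"
    using assms by auto
  then show ?thesis
    by (subst measure_uniform_measure) (auto simp: max_def)
qed

lemma measure_unif01_far:
  assumes "0 \<le> r" "x \<in> {0..1}"
  shows "measure unif01 {y. r < \<bar>x - y\<bar>} = max 0 (x - r) + max 0 (1 - r - x)"
proof -
  interpret prob_space unif01
    by (rule prob_space_unif01)
  have "{y. r < \<bar>x - y\<bar>} = {y. y < x - r} \<union> {y. x + r < y}"
    by auto
  moreover have "{y. y < x - r} \<inter> {y. x + r < y} = {}"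
    using assms by auto
  ultimately have "measure unif01 {y. r < \<bar>x - y\<bar>} =
      measure unif01 {y. y < x - r} + measure unif01 {y. x + r < y}"
    by (simp add: finite_measure_Union)
  then show ?thesis
    using assms by (simp add: measure_unif01_less measure_unif01_greater diff_diff_eq add.commute)
qed

section \<open>Integrals of gap lengths over the unit interval\<close>

text \<open>Truncated gap lengths have kinks, so the fundamental theorem is applied to the
  polynomial \<open>f\<close> on its support \<open>{u..v}\<close> and the result is extended by
  zero.\<close>

lemma has_integral_supported_FTC:
  fixes f F :: "real \<Rightarrow> real"
  assumes "a \<le> u" "u \<le> v" "v \<le> b"
    and "\<And>x. (F has_real_derivative f x) (at x)"
    and "\<And>x. x \<in> {u..v} \<Longrightarrow> g x = f x"
    and "\<And>x. x \<in> {a..b} - {u..v} \<Longrightarrow> g x = 0"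
  shows "(g has_integral (F v - F u)) {a..b}"
proof -
  have "(f has_integral (F v - F u)) {u..v}"
    using assms(2,4)
    by (intro fundamental_theorem_of_calculus)
      (auto simp flip: has_real_derivative_iff_has_vector_derivative intro: DERIV_subset)
  then have "((\<lambda>x. if x \<in> {u..v} then f x else 0) has_integral (F v - F u)) {a..b}"
    using assms(1,3) by (subst has_integral_restrict) auto
  then show ?thesis
    by (rule has_integral_eq[rotated]) (use assms(5,6) in auto)
qed

text \<open>The exponent is \<open>Suc n\<close> because a zeroth power would be 1 instead of 0 off
  the support \<open>{r..1}\<close>. The cases \<open>n = 0\<close> and \<open>n = 1\<close> serve
  one and two non-edges at a vertex.\<close>

lemma has_integral_left_gap:
  fixes r :: real
  assumes "0 \<le> r"
  shows "((\<lambda>x. max 0 (x - r) ^ Suc n) has_integral max 0 (1 - r) ^ (n + 2) / (n + 2)) {0..1}"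
proof (cases "r \<le> 1")
  case True
  have "((\<lambda>x. max 0 (x - r) ^ Suc n) has_integral
      (1 - r) ^ (n + 2) / (n + 2) - (r - r) ^ (n + 2) / (n + 2)) {0..1}"
  proof (rule has_integral_supported_FTC[where u = r and v = 1 and f = "\<lambda>x. (x - r) ^ Suc n"])
    fix x
    have "((\<lambda>x. (x - r) ^ (n + 2) / (n + 2)) has_real_derivative
        real (n + 2) * (x - r) ^ Suc n / (n + 2)) (at x)"
      by (rule DERIV_cdivide) (rule derivative_eq_intros refl | simp)+
    then show "((\<lambda>x. (x - r) ^ (n + 2) / (n + 2)) has_real_derivative (x - r) ^ Suc n) (at x)"
      by (simp del: of_nat_add)
  qed (use assms True in auto)
  then show ?thesis
    using True by simp
next
  case False
  then have "max 0 (x - r) ^ Suc n = 0" if "x \<in> {0..1}" for x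
    using that by simp
  then have "((\<lambda>x. max 0 (x - r) ^ Suc n) has_integral 0) {0..1}"
    by (intro has_integral_is_0) blast
  then show ?thesis
    using False by simp
qed

text \<open>The reflection of \<open>x\<close> to \<open>1 - x\<close> swaps the two gaps.\<close>

lemma has_integral_right_gap:
  fixes r :: real
  assumes "0 \<le> r"
  shows "((\<lambda>x. max 0 (1 - r - x) ^ Suc n) has_integral max 0 (1 - r) ^ (n + 2) / (n + 2)) {0..1}"
proof -
  have "((\<lambda>x. max 0 (1 - x - r) ^ Suc n) has_integral max 0 (1 - r) ^ (n + 2) / (n + 2)) {1 - 1..1 - 0}"
    using has_integral_affinity[OF has_integral_left_gap[OF assms, of n, unfolded cbox_interval[symmetric]], of "-1" 1]
    by (simp add: image_affinity_atLeastAtMost)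
  then show ?thesis
    by (simp add: algebra_simps)
qed

lemma has_integral_both_gaps:
  fixes r :: real
  assumes "0 \<le> r"
  shows "((\<lambda>x. max 0 (x - r) * max 0 (1 - r - x)) has_integral max 0 (1 - 2 * r) ^ 3 / 6) {0..1}"
proof (cases "r \<le> 1/2")
  case True
  \<comment> \<open>Obtained by writing \<open>1 - r - x\<close> as
    \<open>(1 - 2 * r) - (x - r)\<close> and integrating in powers of \<open>x - r\<close>.\<close>
  let ?F = "\<lambda>x. (1 - 2 * r) * (x - r)\<^sup>2 / 2 - (x - r) ^ 3 / 3"
  have "((\<lambda>x. max 0 (x - r) * max 0 (1 - r - x)) has_integral ?F (1 - r) - ?F r) {0..1}"
    by (rule has_integral_supported_FTC[where u = r and v = "1 - r" and f = "\<lambda>x. (x - r) * (1 - r - x)"])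
      (use assms True in \<open>auto intro!: derivative_eq_intros simp: field_simps power2_eq_square max_def\<close>)
  moreover have "?F (1 - r) - ?F r = (1 - 2 * r) ^ 3 / 6"
    by (simp add: field_simps power2_eq_square power3_eq_cube)
  ultimately show ?thesis
    using True by simp
next
  case False
  \<comment> \<open>A nonempty left gap needs \<open>x > r\<close>, a nonempty right gap
    \<open>x < 1 - r\<close>; for \<open>r > 1/2\<close> these exclude each other.\<close>
  then have "max 0 (x - r) * max 0 (1 - r - x) = 0" for x
    by (auto simp: max_def)
  then have "((\<lambda>x. max 0 (x - r) * max 0 (1 - r - x)) has_integral 0) {0..1}"
    by (intro has_integral_is_0) blast
  then show ?thesis
    using False by simp
qed

section \<open>Product laws and inclusion-exclusion\<close>

text \<open>Independence of blocks of indices concerns functions in \<open>PiM\<close> spaces. Here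
  \<open>f\<close> and \<open>g\<close> will read off coordinates, and the product law of
  \<open>(Y, Z)\<close> is pushed forward componentwise.\<close>

lemma (in prob_space) distr_pair_indep_var:
  assumes indep: "indep_var A Y B Z"
    and f [measurable]: "f \<in> A \<rightarrow>\<^sub>M N" and g [measurable]: "g \<in> B \<rightarrow>\<^sub>M K"
  shows "distr M (N \<Otimes>\<^sub>M K) (\<lambda>\<omega>. (f (Y \<omega>), g (Z \<omega>))) =
    distr M N (\<lambda>\<omega>. f (Y \<omega>)) \<Otimes>\<^sub>M distr M K (\<lambda>\<omega>. g (Z \<omega>))"
proof -
  have [measurable]: "random_variable A Y" "random_variable B Z"
    using indep by (blast dest: indep_var_rv1 indep_var_rv2)+
  have "distr M N (\<lambda>\<omega>. f (Y \<omega>)) = distr (distr M A Y) N f"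
    "distr M K (\<lambda>\<omega>. g (Z \<omega>)) = distr (distr M B Z) K g"
    by (simp_all add: distr_distr comp_def)
  moreover have "prob_space (distr M K (\<lambda>\<omega>. g (Z \<omega>)))"
    by (intro prob_space_distr) measurable
  ultimately have "distr M N (\<lambda>\<omega>. f (Y \<omega>)) \<Otimes>\<^sub>M distr M K (\<lambda>\<omega>. g (Z \<omega>)) =
      distr (distr M A Y \<Otimes>\<^sub>M distr M B Z) (N \<Otimes>\<^sub>M K) (\<lambda>(y, z). (f y, g z))"
    by (simp add: pair_measure_distr prob_space_imp_sigma_finite)
  also have "distr M A Y \<Otimes>\<^sub>M distr M B Z = distr M (A \<Otimes>\<^sub>M B) (\<lambda>\<omega>. (Y \<omega>, Z \<omega>))"
    using indep by (simp add: indep_var_distribution_eq)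
  finally show ?thesis
    by (simp add: distr_distr comp_def)
qed

lemma (in prob_space) prob_split:
  assumes "Measurable.pred M P" "Measurable.pred M Q"
    and "\<And>\<omega>. R \<omega> \<longleftrightarrow> P \<omega> \<or> Q \<omega>" "\<And>\<omega>. \<not> (P \<omega> \<and> Q \<omega>)"
  shows "prob {\<omega> \<in> space M. R \<omega>} = prob {\<omega> \<in> space M. P \<omega>} + prob {\<omega> \<in> space M. Q \<omega>}"
proof -
  have "{\<omega> \<in> space M. R \<omega>} = {\<omega> \<in> space M. P \<omega>} \<union> {\<omega> \<in> space M. Q \<omega>}"
    using assms(3) by auto
  moreover have "{\<omega> \<in> space M. P \<omega>} \<inter> {\<omega> \<in> space M. Q \<omega>} = {}"
    using assms(4) by auto
  ultimately show ?thesis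
    using assms(1,2) by (simp add: finite_measure_Union)
qed

text \<open>Inclusion-exclusion as a linear system: each equation in \<open>splits\<close> divides
  one event by another, and the atoms follow by linear arithmetic. Symmetry leaves one value per
  number of occurring events.\<close>

lemma (in prob_space) prob_atoms_of_three:
  assumes [measurable]: "Measurable.pred M A" "Measurable.pred M B" "Measurable.pred M C"
    and "prob {\<omega> \<in> space M. A \<omega>} = p" "prob {\<omega> \<in> space M. B \<omega>} = p" "prob {\<omega> \<in> space M. C \<omega>} = p"
    and "prob {\<omega> \<in> space M. A \<omega> \<and> B \<omega>} = q" "prob {\<omega> \<in> space M. A \<omega> \<and> C \<omega>} = q"
      "prob {\<omega> \<in> space M. B \<omega> \<and> C \<omega>} = q"
    and "prob {\<omega> \<in> space M. A \<omega> \<and> B \<omega> \<and> C \<omega>} = s"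
  shows "prob {\<omega> \<in> space M. A \<omega> \<and> B \<omega> \<and> \<not> C \<omega>} = q - s"
    "prob {\<omega> \<in> space M. A \<omega> \<and> \<not> B \<omega> \<and> C \<omega>} = q - s"
    "prob {\<omega> \<in> space M. \<not> A \<omega> \<and> B \<omega> \<and> C \<omega>} = q - s"
    "prob {\<omega> \<in> space M. A \<omega> \<and> \<not> B \<omega> \<and> \<not> C \<omega>} = p - 2 * q + s"
    "prob {\<omega> \<in> space M. \<not> A \<omega> \<and> B \<omega> \<and> \<not> C \<omega>} = p - 2 * q + s"
    "prob {\<omega> \<in> space M. \<not> A \<omega> \<and> \<not> B \<omega> \<and> C \<omega>} = p - 2 * q + s"
    "prob {\<omega> \<in> space M. \<not> A \<omega> \<and> \<not> B \<omega> \<and> \<not> C \<omega>} = 1 - 3 * p + 3 * q - s"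
proof -
  have splits:
    "prob {\<omega> \<in> space M. A \<omega> \<and> B \<omega>} =
      prob {\<omega> \<in> space M. A \<omega> \<and> B \<omega> \<and> C \<omega>} + prob {\<omega> \<in> space M. A \<omega> \<and> B \<omega> \<and> \<not> C \<omega>}"
    "prob {\<omega> \<in> space M. A \<omega> \<and> C \<omega>} =
      prob {\<omega> \<in> space M. A \<omega> \<and> B \<omega> \<and> C \<omega>} + prob {\<omega> \<in> space M. A \<omega> \<and> \<not> B \<omega> \<and> C \<omega>}"
    "prob {\<omega> \<in> space M. B \<omega> \<and> C \<omega>} =
      prob {\<omega> \<in> space M. A \<omega> \<and> B \<omega> \<and> C \<omega>} + prob {\<omega> \<in> space M. \<not> A \<omega> \<and> B \<omega> \<and> C \<omega>}"
    "prob {\<omega> \<in> space M. A \<omega> \<and> \<not> B \<omega>} =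
      prob {\<omega> \<in> space M. A \<omega> \<and> \<not> B \<omega> \<and> C \<omega>} + prob {\<omega> \<in> space M. A \<omega> \<and> \<not> B \<omega> \<and> \<not> C \<omega>}"
    "prob {\<omega> \<in> space M. A \<omega>} =
      prob {\<omega> \<in> space M. A \<omega> \<and> B \<omega>} + prob {\<omega> \<in> space M. A \<omega> \<and> \<not> B \<omega>}"
    "prob {\<omega> \<in> space M. B \<omega> \<and> \<not> C \<omega>} =
      prob {\<omega> \<in> space M. A \<omega> \<and> B \<omega> \<and> \<not> C \<omega>} + prob {\<omega> \<in> space M. \<not> A \<omega> \<and> B \<omega> \<and> \<not> C \<omega>}"
    "prob {\<omega> \<in> space M. B \<omega>} =
      prob {\<omega> \<in> space M. B \<omega> \<and> C \<omega>} + prob {\<omega> \<in> space M. B \<omega> \<and> \<not> C \<omega>}"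
    "prob {\<omega> \<in> space M. C \<omega> \<and> \<not> A \<omega>} =
      prob {\<omega> \<in> space M. \<not> A \<omega> \<and> B \<omega> \<and> C \<omega>} + prob {\<omega> \<in> space M. \<not> A \<omega> \<and> \<not> B \<omega> \<and> C \<omega>}"
    "prob {\<omega> \<in> space M. C \<omega>} =
      prob {\<omega> \<in> space M. A \<omega> \<and> C \<omega>} + prob {\<omega> \<in> space M. C \<omega> \<and> \<not> A \<omega>}"
    "prob {\<omega> \<in> space M. \<not> A \<omega> \<and> B \<omega>} =
      prob {\<omega> \<in> space M. \<not> A \<omega> \<and> B \<omega> \<and> C \<omega>} + prob {\<omega> \<in> space M. \<not> A \<omega> \<and> B \<omega> \<and> \<not> C \<omega>}"
    "prob {\<omega> \<in> space M. \<not> A \<omega> \<and> \<not> B \<omega>} =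
      prob {\<omega> \<in> space M. \<not> A \<omega> \<and> \<not> B \<omega> \<and> C \<omega>} + prob {\<omega> \<in> space M. \<not> A \<omega> \<and> \<not> B \<omega> \<and> \<not> C \<omega>}"
    "prob {\<omega> \<in> space M. \<not> A \<omega>} =
      prob {\<omega> \<in> space M. \<not> A \<omega> \<and> B \<omega>} + prob {\<omega> \<in> space M. \<not> A \<omega> \<and> \<not> B \<omega>}"
    "prob {\<omega> \<in> space M. True} = prob {\<omega> \<in> space M. A \<omega>} + prob {\<omega> \<in> space M. \<not> A \<omega>}"
    by (rule prob_split; (blast | measurable))+
  have total: "prob {\<omega> \<in> space M. True} = 1"
    using prob_space by simp
  show "prob {\<omega> \<in> space M. A \<omega> \<and> B \<omega> \<and> \<not> C \<omega>} = q - s"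
    "prob {\<omega> \<in> space M. A \<omega> \<and> \<not> B \<omega> \<and> C \<omega>} = q - s"
    "prob {\<omega> \<in> space M. \<not> A \<omega> \<and> B \<omega> \<and> C \<omega>} = q - s"
    "prob {\<omega> \<in> space M. A \<omega> \<and> \<not> B \<omega> \<and> \<not> C \<omega>} = p - 2 * q + s"
    "prob {\<omega> \<in> space M. \<not> A \<omega> \<and> B \<omega> \<and> \<not> C \<omega>} = p - 2 * q + s"
    "prob {\<omega> \<in> space M. \<not> A \<omega> \<and> \<not> B \<omega> \<and> C \<omega>} = p - 2 * q + s"
    "prob {\<omega> \<in> space M. \<not> A \<omega> \<and> \<not> B \<omega> \<and> \<not> C \<omega>} = 1 - 3 * p + 3 * q - s"
    using splits assms(4-) total by linarith+
qed

section \<open>Labelled graphs on three vertices\<close>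

text \<open>Pairs each graph without the edge \<open>a\<close> with the one that has it; three uses
  expand the sum over graphs into eight terms.\<close>

lemma sum_Pow_insert:
  fixes f :: "'v set \<Rightarrow> real"
  assumes "finite F" "a \<notin> F"
  shows "sum f (Pow (insert a F)) = (\<Sum>g\<in>Pow F. f g + f (insert a g))"
proof -
  have "inj_on (insert a) (Pow F)"
    using assms(2) by (intro inj_onI) (metis PowD in_mono insert_ident)
  moreover have "Pow F \<inter> insert a ` Pow F = {}"
    using assms(2) by auto
  ultimately show ?thesis
    using assms(1) by (simp add: Pow_insert sum.union_disjoint sum.reindex sum.distrib)
qed

lemma edges_of_three_vertices:
  "{e. e \<subseteq> {1, 2, 3 :: nat} \<and> card e = 2} = {{1, 2}, {1, 3}, {2, 3}}"
proof -
  have "{e. e \<subseteq> {1, 2, 3 :: nat} \<and> card e = 2} = {e \<in> Pow {1, 2, 3}. card e = 2}"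
    by auto
  also have "\<dots> = {{1, 2}, {1, 3}, {2, 3}}"
    by (auto simp: Pow_insert)
  finally show ?thesis .
qed

lemma sum_labelled_graphs_three:
  fixes f :: "nat set set \<Rightarrow> real"
  shows "sum f (labelled_graphs {1, 2, 3}) =
    f {} + f {{1, 2}} + f {{1, 3}} + f {{2, 3}} + f {{1, 2}, {1, 3}} + f {{1, 2}, {2, 3}}
      + f {{1, 3}, {2, 3}} + f {{1, 2}, {1, 3}, {2, 3}}"
  unfolding labelled_graphs_def edges_of_three_vertices
  by (simp add: sum_Pow_insert doubleton_eq_iff)

lemma hard_rgg_three:
  "hard_rgg {1, 2, 3 :: nat} r x =
    (if \<bar>x 1 - x 2\<bar> \<le> r then {{1, 2}} else {}) \<union>
    (if \<bar>x 1 - x 3\<bar> \<le> r then {{1, 3}} else {}) \<union>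
    (if \<bar>x 2 - x 3\<bar> \<le> r then {{2, 3}} else {})"
proof -
  \<comment> \<open>Bounded quantifiers over the explicit vertex set let all pairs be
    enumerated.\<close>
  have "hard_rgg {1, 2, 3 :: nat} r x =
      {e. \<exists>i\<in>{1, 2, 3}. \<exists>j\<in>{1, 2, 3}. e = {i, j} \<and> i \<noteq> j \<and> \<bar>x i - x j\<bar> \<le> r}"
    unfolding hard_rgg_def by blast
  then show ?thesis
    by (auto simp: abs_minus_commute insert_commute)
qed

text \<open>For a concrete \<open>g\<close> this turns the event of drawing \<open>g\<close> into an
  atom of the three edge events.\<close>

lemma hard_rgg_three_eq_iff:
  "hard_rgg {1, 2, 3 :: nat} r x = g \<longleftrightarrow> g \<subseteq> {{1, 2}, {1, 3}, {2, 3}} \<and>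
    (\<bar>x 1 - x 2\<bar> \<le> r \<longleftrightarrow> {1, 2} \<in> g) \<and>
    (\<bar>x 1 - x 3\<bar> \<le> r \<longleftrightarrow> {1, 3} \<in> g) \<and>
    (\<bar>x 2 - x 3\<bar> \<le> r \<longleftrightarrow> {2, 3} \<in> g)" (is "?L \<longleftrightarrow> ?R")
proof
  assume ?L
  then show ?R
    unfolding hard_rgg_three by (auto simp: doubleton_eq_iff split: if_splits)
next
  assume ?R
  then show ?L
    unfolding hard_rgg_three by auto
qed

text \<open>All probabilities are 0 or 1, and both \<open>0 * log 2 0\<close> and
  \<open>1 * log 2 1\<close> vanish. This serves negative radii.\<close>

lemma (in prob_space) graph_entropy_const:
  assumes "\<And>\<omega>. G \<omega> = h"
  shows "graph_entropy M V G = 0"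
proof -
  have "prob {\<omega> \<in> space M. G \<omega> = g} = of_bool (h = g)" for g
    using assms prob_space by simp
  then have "prob {\<omega> \<in> space M. G \<omega> = g} * log 2 (prob {\<omega> \<in> space M. G \<omega> = g}) = 0" for g
    by simp
  then show ?thesis
    unfolding graph_entropy_def by (simp only: sum.neutral_const minus_zero)
qed

section \<open>Distances between three independent uniform points\<close>

locale three_uniform_points = prob_space M for M :: "'a measure" +
  fixes X :: "nat \<Rightarrow> 'a \<Rightarrow> real"
  assumes indep: "indep_vars (\<lambda>_. borel) X {1, 2, 3}"
    and unif: "\<And>i. i \<in> {1, 2, 3} \<Longrightarrow> distr M lborel (X i) = unif01"
begin

text \<open>The copy for \<open>Suc 0\<close> covers the form into which simp rewrites
  \<open>X 1\<close>.\<close>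

lemma measurable_X:
  "random_variable borel (X 1)" "random_variable borel (X 2)" "random_variable borel (X 3)"
    "random_variable borel (X (Suc 0))"
  using indep by (auto simp: indep_vars_def)

declare measurable_X [measurable]

lemma distr_X:
  assumes "i \<in> {1, 2, 3}"
  shows "distr M borel (X i) = unif01"
  using unif[OF assms] by (metis distr_cong sets_lborel)

text \<open>First \<open>i\<close> and \<open>k\<close> are separated, then \<open>j\<close> from
  that pair. The point \<open>j\<close> comes first since slices will be taken at its
  position.\<close>

lemma joint_distr:
  assumes "distinct [i, j, k]" "{i, j, k} \<subseteq> {1, 2, 3}"
  shows "distr M (borel \<Otimes>\<^sub>M (borel \<Otimes>\<^sub>M borel)) (\<lambda>\<omega>. (X j \<omega>, X i \<omega>, X k \<omega>)) =
    unif01 \<Otimes>\<^sub>M (unif01 \<Otimes>\<^sub>M unif01)"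
proof -
  have "indep_var (PiM {i} (\<lambda>_. borel)) (\<lambda>\<omega>. \<lambda>l\<in>{i}. X l \<omega>)
      (PiM {k} (\<lambda>_. borel)) (\<lambda>\<omega>. \<lambda>l\<in>{k}. X l \<omega>)"
    using assms by (intro indep_var_restrict[OF indep]) auto
  from distr_pair_indep_var[OF this, of "\<lambda>f. f i" borel "\<lambda>f. f k" borel]
  have ik: "distr M (borel \<Otimes>\<^sub>M borel) (\<lambda>\<omega>. (X i \<omega>, X k \<omega>)) = unif01 \<Otimes>\<^sub>M unif01"
    using assms by (simp add: distr_X)
  have "indep_var (PiM {j} (\<lambda>_. borel)) (\<lambda>\<omega>. \<lambda>l\<in>{j}. X l \<omega>)
      (PiM {i, k} (\<lambda>_. borel)) (\<lambda>\<omega>. \<lambda>l\<in>{i, k}. X l \<omega>)"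
    using assms by (intro indep_var_restrict[OF indep]) auto
  from distr_pair_indep_var[OF this, of "\<lambda>f. f j" borel "\<lambda>f. (f i, f k)" "borel \<Otimes>\<^sub>M borel"]
  show ?thesis
    using assms by (simp add: distr_X ik)
qed

text \<open>Fubini: given \<open>X j = x\<close>, the other two coordinates are independent and uniform.\<close>

lemma prob_conditioned_on_one:
  assumes "distinct [i, j, k]" "{i, j, k} \<subseteq> {1, 2, 3}"
    and P [measurable]: "Measurable.pred (borel \<Otimes>\<^sub>M borel) (\<lambda>(x, y). P x y)"
    and Q [measurable]: "Measurable.pred (borel \<Otimes>\<^sub>M borel) (\<lambda>(x, y). Q x y)"
    and int: "((\<lambda>x. measure unif01 {y. P x y} * measure unif01 {z. Q x z}) has_integral I) {0..1}"
  shows "prob {\<omega> \<in> space M. P (X j \<omega>) (X i \<omega>) \<and> Q (X j \<omega>) (X k \<omega>)} = I"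
proof -
  interpret U: prob_space unif01
    by (rule prob_space_unif01)
  interpret UU: pair_prob_space unif01 unif01 ..
  let ?S = "{w \<in> space (borel \<Otimes>\<^sub>M (borel \<Otimes>\<^sub>M borel)). P (fst w) (fst (snd w)) \<and> Q (fst w) (snd (snd w))}"
  have [measurable]: "random_variable borel (X i)" "random_variable borel (X j)" "random_variable borel (X k)"
    using assms(2) measurable_X by auto
  have P': "Measurable.pred (borel \<Otimes>\<^sub>M (borel \<Otimes>\<^sub>M borel)) (\<lambda>w. P (fst w) (fst (snd w)))"
    using measurable_compose[OF _ P, of "\<lambda>w. (fst w, fst (snd w))"] by simp
  have Q': "Measurable.pred (borel \<Otimes>\<^sub>M (borel \<Otimes>\<^sub>M borel)) (\<lambda>w. Q (fst w) (snd (snd w)))"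
    using measurable_compose[OF _ Q, of "\<lambda>w. (fst w, snd (snd w))"] by simp
  have S: "?S \<in> sets (borel \<Otimes>\<^sub>M (borel \<Otimes>\<^sub>M borel))"
    using P' Q' by measurable
  have Px: "{y. P x y} \<in> sets borel" and Qx: "{y. Q x y} \<in> sets borel" for x
    using measurable_compose[OF measurable_Pair1' P, of x] measurable_compose[OF measurable_Pair1' Q, of x]
    by (auto simp: pred_def)
  have sets_U: "sets (unif01 \<Otimes>\<^sub>M (unif01 \<Otimes>\<^sub>M unif01)) = sets (borel \<Otimes>\<^sub>M (borel \<Otimes>\<^sub>M borel))"
    by (intro sets_pair_measure_cong) auto
  let ?g = "\<lambda>x. measure unif01 {y. P x y} * measure unif01 {z. Q x z}"
  \<comment> \<open>With \<open>x\<close> fixed, \<open>P\<close> and \<open>Q\<close> constrain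
    different coordinates, so the slice is a rectangle and its measure a product.\<close>
  have slice: "emeasure (unif01 \<Otimes>\<^sub>M unif01) (Pair x -` ?S) = ennreal (?g x)" for x
  proof -
    have "Pair x -` ?S = {y. P x y} \<times> {z. Q x z}"
      by (auto simp: space_pair_measure)
    then show ?thesis
      using Px[of x] Qx[of x]
      by (simp add: U.emeasure_pair_measure_Times U.emeasure_eq_measure ennreal_mult')
  qed
  have meas: "(\<lambda>x. ennreal (?g x)) \<in> borel_measurable borel"
    using UU.measurable_emeasure_Pair[of ?S unif01] S sets_U slice
    by simp
  have "emeasure M {\<omega> \<in> space M. P (X j \<omega>) (X i \<omega>) \<and> Q (X j \<omega>) (X k \<omega>)} =
      emeasure (distr M (borel \<Otimes>\<^sub>M (borel \<Otimes>\<^sub>M borel)) (\<lambda>\<omega>. (X j \<omega>, X i \<omega>, X k \<omega>))) ?S"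
    using S by (subst emeasure_distr) (auto simp: space_pair_measure intro!: arg_cong[where f = "emeasure M"])
  also have "\<dots> = (\<integral>\<^sup>+x. emeasure (unif01 \<Otimes>\<^sub>M unif01) (Pair x -` ?S) \<partial>unif01)"
    using S sets_U by (simp add: joint_distr[OF assms(1,2)] UU.emeasure_pair_measure_alt)
  \<comment> \<open>The unit interval has Lebesgue measure 1, so the uniform density is its
    indicator.\<close>
  also have "\<dots> = (\<integral>\<^sup>+x. ennreal (?g x) * indicator {0..1} x \<partial>lborel)"
    unfolding slice using meas by (subst nn_integral_uniform_measure) (auto simp: divide_ennreal_def)
  also have "\<dots> = ennreal I"
    using int by (intro nn_integral_has_integral_lebesgue') auto
  \<comment> \<open>Since \<open>ennreal\<close> sends negative reals to 0, returning to real
    numbers uses \<open>I \<ge> 0\<close>.\<close>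
  finally show ?thesis
    using has_integral_nonneg[OF int] by (simp add: emeasure_eq_measure measure_nonneg)
qed

text \<open>The third point \<open>k\<close> enters with the condition \<open>True\<close> of
  probability 1; each gap contributes half of the result.\<close>

lemma prob_far:
  assumes "0 \<le> r" "distinct [i, j, k]" "{i, j, k} \<subseteq> {1, 2, 3}"
  shows "prob {\<omega> \<in> space M. r < \<bar>X j \<omega> - X i \<omega>\<bar>} = (max 0 (1 - r))\<^sup>2"
proof -
  interpret U: prob_space unif01
    by (rule prob_space_unif01)
  have "((\<lambda>x. max 0 (x - r) + max 0 (1 - r - x)) has_integral (max 0 (1 - r))\<^sup>2) {0..1}"
    using has_integral_add[OF has_integral_left_gap[OF assms(1), of 0] has_integral_right_gap[OF assms(1), of 0]]
    by (simp add: power2_eq_square)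
  then have "((\<lambda>x. measure unif01 {y. r < \<bar>x - y\<bar>} * measure unif01 {z. True}) has_integral
      (max 0 (1 - r))\<^sup>2) {0..1}"
    by (rule has_integral_eq[rotated]) (use assms(1) U.prob_space in \<open>simp add: measure_unif01_far\<close>)
  from prob_conditioned_on_one[OF assms(2,3) _ _ this] show ?thesis
    by simp
qed

text \<open>Given the shared vertex, the probability is the squared sum of its gaps: two squares and
  twice the mixed product.\<close>

lemma prob_far_far:
  assumes "0 \<le> r" "distinct [i, j, k]" "{i, j, k} \<subseteq> {1, 2, 3}"
  shows "prob {\<omega> \<in> space M. r < \<bar>X j \<omega> - X i \<omega>\<bar> \<and> r < \<bar>X j \<omega> - X k \<omega>\<bar>} =
    2/3 * max 0 (1 - r) ^ 3 + 1/3 * max 0 (1 - 2 * r) ^ 3"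
proof -
  let ?a = "\<lambda>x. max 0 (x - r)" and ?b = "\<lambda>x. max 0 (1 - r - x)"
  have "((\<lambda>x. (?a x)\<^sup>2 + (?b x)\<^sup>2 + 2 * (?a x * ?b x)) has_integral
      (2/3 * max 0 (1 - r) ^ 3 + 1/3 * max 0 (1 - 2 * r) ^ 3)) {0..1}"
    using has_integral_add[OF has_integral_add[OF
        has_integral_left_gap[OF assms(1), of 1] has_integral_right_gap[OF assms(1), of 1]]
        has_integral_mult_right[OF has_integral_both_gaps[OF assms(1)], of 2]]
    by (simp add: numeral_eq_Suc)
  then have "((\<lambda>x. measure unif01 {y. r < \<bar>x - y\<bar>} * measure unif01 {z. r < \<bar>x - z\<bar>}) has_integral
      (2/3 * max 0 (1 - r) ^ 3 + 1/3 * max 0 (1 - 2 * r) ^ 3)) {0..1}"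
    by (rule has_integral_eq[rotated])
      (use assms(1) in \<open>simp add: measure_unif01_far power2_eq_square algebra_simps\<close>)
  from prob_conditioned_on_one[OF assms(2,3) _ _ this] show ?thesis
    by simp
qed

lemma prob_ordered_far:
  assumes "0 \<le> r" "distinct [i, j, k]" "{i, j, k} \<subseteq> {1, 2, 3}"
  shows "prob {\<omega> \<in> space M. X i \<omega> < X j \<omega> - r \<and> X j \<omega> + r < X k \<omega>} = max 0 (1 - 2 * r) ^ 3 / 6"
proof -
  have "((\<lambda>x. measure unif01 {y. y < x - r} * measure unif01 {z. x + r < z}) has_integral
      max 0 (1 - 2 * r) ^ 3 / 6) {0..1}"
    by (rule has_integral_eq[OF _ has_integral_both_gaps[OF assms(1)]])
      (use assms(1) in \<open>simp add: measure_unif01_less measure_unif01_greater, simp add: algebra_simps\<close>)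
  from prob_conditioned_on_one[OF assms(2,3) _ _ this] show ?thesis
    by simp
qed

lemma prob_all_far:
  assumes "0 \<le> r"
  shows "prob {\<omega> \<in> space M. r < \<bar>X 1 \<omega> - X 2 \<omega>\<bar> \<and> r < \<bar>X 1 \<omega> - X 3 \<omega>\<bar> \<and> r < \<bar>X 2 \<omega> - X 3 \<omega>\<bar>} =
    max 0 (1 - 2 * r) ^ 3"
proof -
  let ?orders = "{(1, 2, 3), (1, 3, 2), (2, 1, 3), (2, 3, 1), (3, 1, 2), (3, 2, 1)} :: (nat \<times> nat \<times> nat) set"
  let ?E = "\<lambda>(i, j, k). {\<omega> \<in> space M. X i \<omega> < X j \<omega> - r \<and> X j \<omega> + r < X k \<omega>}"
  have E: "prob (?E t) = max 0 (1 - 2 * r) ^ 3 / 6" if "t \<in> ?orders" for t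
    using that prob_ordered_far[OF assms] by auto
  \<comment> \<open>Distances above \<open>r \<ge> 0\<close> make the positions distinct, hence
    sorted in exactly one order; conversely, the outer points of an order are more than
    \<open>2 * r\<close> apart.\<close>
  have "{\<omega> \<in> space M. r < \<bar>X 1 \<omega> - X 2 \<omega>\<bar> \<and> r < \<bar>X 1 \<omega> - X 3 \<omega>\<bar> \<and> r < \<bar>X 2 \<omega> - X 3 \<omega>\<bar>} =
      (\<Union>t\<in>?orders. ?E t)"
    using assms by auto
  moreover have "disjoint_family_on ?E ?orders"
    using assms by (auto simp: disjoint_family_on_def)
  moreover have "?E ` ?orders \<subseteq> events"
    by auto
  ultimately have "prob {\<omega> \<in> space M. r < \<bar>X 1 \<omega> - X 2 \<omega>\<bar> \<and> r < \<bar>X 1 \<omega> - X 3 \<omega>\<bar> \<and> r < \<bar>X 2 \<omega> - X 3 \<omega>\<bar>} =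
      (\<Sum>t\<in>?orders. prob (?E t))"
    by (simp only: finite_measure_finite_Union[of ?orders ?E] finite.intros)
  also have "\<dots> = (\<Sum>t\<in>?orders. max 0 (1 - 2 * r) ^ 3 / 6)"
    by (rule sum.cong[OF refl E])
  finally show ?thesis
    by simp
qed

text \<open>The terms group the eight graphs by number of edges, from three down to none, with 1, 3,
  3 and 1 graphs.\<close>

lemma graph_entropy_three:
  assumes "0 \<le> r"
  defines "c \<equiv> max 0 (1 - r)" and "d \<equiv> max 0 (1 - 2 * r)"
  shows "graph_entropy M {1, 2, 3} (\<lambda>\<omega>. hard_rgg {1, 2, 3} r (\<lambda>i. X i \<omega>)) =
    - ((1 - 3 * c\<^sup>2 + 2 * c ^ 3) * log 2 (1 - 3 * c\<^sup>2 + 2 * c ^ 3)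
      + 3 * ((c\<^sup>2 - 4/3 * c ^ 3 + 1/3 * d ^ 3) * log 2 (c\<^sup>2 - 4/3 * c ^ 3 + 1/3 * d ^ 3))
      + 3 * ((2/3 * c ^ 3 - 2/3 * d ^ 3) * log 2 (2/3 * c ^ 3 - 2/3 * d ^ 3))
      + d ^ 3 * log 2 (d ^ 3))"
proof -
  let ?A = "\<lambda>\<omega>. r < \<bar>X 1 \<omega> - X 2 \<omega>\<bar>" and ?B = "\<lambda>\<omega>. r < \<bar>X 1 \<omega> - X 3 \<omega>\<bar>"
    and ?C = "\<lambda>\<omega>. r < \<bar>X 2 \<omega> - X 3 \<omega>\<bar>"
  let ?q = "2/3 * c ^ 3 + 1/3 * d ^ 3"
  note far = prob_far[OF assms(1)] and far_far = prob_far_far[OF assms(1)]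
  have p: "prob {\<omega> \<in> space M. ?A \<omega>} = c\<^sup>2" "prob {\<omega> \<in> space M. ?B \<omega>} = c\<^sup>2" "prob {\<omega> \<in> space M. ?C \<omega>} = c\<^sup>2"
    using far[of 2 1 3] far[of 3 1 2] far[of 3 2 1] by (simp_all add: c_def)
  \<comment> \<open>Two non-edges always share a vertex: 1, 2 and 3 in turn, given as the middle
    index.\<close>
  have q: "prob {\<omega> \<in> space M. ?A \<omega> \<and> ?B \<omega>} = ?q" "prob {\<omega> \<in> space M. ?A \<omega> \<and> ?C \<omega>} = ?q"
    "prob {\<omega> \<in> space M. ?B \<omega> \<and> ?C \<omega>} = ?q"
    using far_far[of 2 1 3] far_far[of 1 2 3] far_far[of 1 3 2]
    by (simp_all add: c_def d_def abs_minus_commute)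
  have s: "prob {\<omega> \<in> space M. ?A \<omega> \<and> ?B \<omega> \<and> ?C \<omega>} = d ^ 3"
    using prob_all_far[OF assms(1)] by (simp add: d_def)
  have "Measurable.pred M ?A" "Measurable.pred M ?B" "Measurable.pred M ?C"
    by measurable
  note atoms = prob_atoms_of_three[OF this p q s]
  have *: "?q - d ^ 3 = 2/3 * c ^ 3 - 2/3 * d ^ 3"
    "c\<^sup>2 - 2 * ?q + d ^ 3 = c\<^sup>2 - 4/3 * c ^ 3 + 1/3 * d ^ 3"
    "1 - 3 * c\<^sup>2 + 3 * ?q - d ^ 3 = 1 - 3 * c\<^sup>2 + 2 * c ^ 3"
    by simp_all
  \<comment> \<open>Edges become negated non-edges, as in \<open>atoms\<close>;
    \<open>not_less\<close> is removed below so that simp does not undo this.\<close>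
  have le: "x \<le> r \<longleftrightarrow> \<not> r < x" for x
    by auto
  show ?thesis
    unfolding graph_entropy_def sum_labelled_graphs_three hard_rgg_three_eq_iff le
    using atoms[unfolded *] s by (simp add: doubleton_eq_iff del: not_less)
qed

end

section \<open>Comparison with the closed forms, by range of the radius\<close>

theorem mainTheorem6:
  fixes M :: "'a measure" and X :: "nat \<Rightarrow> 'a \<Rightarrow> real" and r\<^sub>0 :: real
  assumes "prob_space M"
    and "prob_space.indep_vars M (\<lambda>_. borel) X {1, 2, 3}"
    and "\<And>i. i \<in> {1, 2, 3} \<Longrightarrow> distr M lborel (X i) = uniform_measure lborel {0..1}"
  shows "graph_entropy M {1, 2, 3} (\<lambda>\<omega>. hard_rgg {1, 2, 3} r\<^sub>0 (\<lambda>i. X i \<omega>)) =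
    (if 0 \<le> r\<^sub>0 \<and> r\<^sub>0 < 1/2 then H_less r\<^sub>0
     else if 1/2 \<le> r\<^sub>0 \<and> r\<^sub>0 \<le> 1 then H_greater r\<^sub>0
     else 0)"
proof -
  interpret three_uniform_points M X
    using assms by (simp add: three_uniform_points_def three_uniform_points_axioms_def)
  let ?r = r\<^sub>0
  consider "?r < 0" | "0 \<le> ?r" "?r < 1/2" | "1/2 \<le> ?r" "?r \<le> 1" | "1 < ?r"
    by linarith
  then show ?thesis
  proof cases
    case 1
    have "hard_rgg {1, 2, 3} ?r (\<lambda>i. X i \<omega>) = {}" for \<omega>
      unfolding hard_rgg_three_eq_iff using 1 by auto
    then show ?thesis
      using 1 graph_entropy_const[of "\<lambda>\<omega>. hard_rgg {1, 2, 3} ?r (\<lambda>i. X i \<omega>)" "{}"] by simp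
  next
    case 2
    \<comment> \<open>Neither truncation is active here: \<open>c = 1 - r\<close> and
      \<open>d = 1 - 2 * r\<close>.\<close>
    have "1 - 3 * (1 - ?r)\<^sup>2 + 2 * (1 - ?r) ^ 3 = 3 * ?r\<^sup>2 - 2 * ?r ^ 3"
      "(1 - ?r)\<^sup>2 - 4/3 * (1 - ?r) ^ 3 + 1/3 * (1 - 2 * ?r) ^ 3 = ?r\<^sup>2 - 4/3 * ?r ^ 3"
      "2/3 * (1 - ?r) ^ 3 - 2/3 * (1 - 2 * ?r) ^ 3 = 14/3 * ?r ^ 3 - 6 * ?r\<^sup>2 + 2 * ?r"
      by (simp_all add: field_simps power2_eq_square power3_eq_cube)
    then show ?thesis
      using 2 graph_entropy_three[of ?r] by (simp add: H_less_def) (simp add: algebra_simps)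
  next
    case 3
    \<comment> \<open>Now \<open>d = 0\<close>, and \<open>y\<close> is the probability of each
      two-edge graph. The coefficient of its logarithm in \<open>H_greater\<close> is
      \<open>3 * y\<close>, one \<open>y\<close> per such graph.\<close>
    define y where "y = 4/3 * ?r ^ 3 - 1/3 * (3 * ?r - 1)\<^sup>2"
    have "1 - 3 * (1 - ?r)\<^sup>2 + 2 * (1 - ?r) ^ 3 = 3 * ?r\<^sup>2 - 2 * ?r ^ 3"
      "(1 - ?r)\<^sup>2 - 4/3 * (1 - ?r) ^ 3 = y"
      by (simp_all add: y_def field_simps power2_eq_square power3_eq_cube)
    moreover have "4 * ?r ^ 3 - (3 * ?r - 1)\<^sup>2 = 3 * y"
      by (simp add: y_def)
    then have "H_greater ?r = - ((3 * ?r\<^sup>2 - 2 * ?r ^ 3) * log 2 (3 * ?r\<^sup>2 - 2 * ?r ^ 3))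
        - 3 * y * log 2 y - 2 * (1 - ?r) ^ 3 * log 2 (2/3 * (1 - ?r) ^ 3)"
      by (simp only: H_greater_def y_def minus_mult_left)
    ultimately show ?thesis
      using 3 graph_entropy_three[of ?r] by simp
  next
    case 4
    \<comment> \<open>Here \<open>c = d = 0\<close>: the triangle has probability 1 and every term
      vanishes.\<close>
    then show ?thesis
      using graph_entropy_three[of ?r] by simp
  qed
qed

end
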